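(* Let $n\ge 2$, let $x_1,\dots,x_n\in\mathbb{R}$ with $\sum_{k=1}^n x_k\neq 0$, let $u>0$, and let $0<\delta<1$. Let $\delta_2,\dots,\delta_n$ be real random variables with $|\delta_k|\le u$ and $\mathbb{E}[\delta_k]=0$ for $2\le k\le n$, which are mean independent. Let $z_n=\sum_{k=1}^n x_k$, and define $\hat z_1=x_1$ and $\hat z_k=(\hat z_{k-1}+x_k)(1+\delta_k)$ for $2\le k\le n$. For $1\le k\le n-1$ put $$m_k=|x_1|(1+u)^{k-1}+\sum_{j=2}^{k+1}|x_j|(1+u)^{k-j+1}.$$ Then with probability at least $1-\delta$, $$\frac{|\hat z_n-z_n|}{|z_n|}\le\frac{u\sqrt{2\ln\frac{2}{\delta}}\,\sqrt{\sum_{k=1}^{n-1}m_k^2}}{|z_n|}.$$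
   Context: Here $\hat z_n$ is the sequentially computed floating point sum of the deterministic constants $x_1,\dots,x_n$, with $\delta_k$ the (randomly modelled) roundoff error of the $k$-th addition and $u>0$ the unit roundoff. Mean independent means $\mathbb{E}[\delta_k\mid\delta_2,\dots,\delta_{k-1}]=\mathbb{E}[\delta_k]$ for each $k$. *)

theory Defs
  imports "HOL-Probability.Probability"
begin

text \<open>The sub-sigma-algebra generated by the real random variables \<open>X j\<close>, \<open>j \<in> J\<close>.
  It is the trivial one when \<open>J\<close> is empty.\<close>

definition generated_algebra :: "'a measure \<Rightarrow> 'i set \<Rightarrow> ('i \<Rightarrow> 'a \<Rightarrow> real) \<Rightarrow> 'a measure" where
  "generated_algebra M J X =
     sigma (space M) (\<Union>j\<in>J. {X j -` A \<inter> space M | A. A \<in> sets borel})"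

definition mean_independent :: "'a measure \<Rightarrow> nat set \<Rightarrow> (nat \<Rightarrow> 'a \<Rightarrow> real) \<Rightarrow> bool" where
  "mean_independent M I X \<longleftrightarrow>
     (\<forall>k\<in>I. AE \<omega> in M.
        real_cond_exp M (generated_algebra M {j\<in>I. j < k} X) (X k) \<omega> = (\<integral>\<omega>'. X k \<omega>' \<partial>M))"

text \<open>Sequential summation of \<open>x 1, x 2, \<dots>\<close> with relative roundoff \<open>d k\<close> in the addition that
  brings in \<open>x k\<close>, for \<open>k \<ge> 2\<close>. Summands are indexed from 1; the value at index 0 is a dummy.\<close>

fun fl_sum :: "(nat \<Rightarrow> real) \<Rightarrow> (nat \<Rightarrow> real) \<Rightarrow> nat \<Rightarrow> real" where
  "fl_sum x d 0 = 0"
| "fl_sum x d (Suc 0) = x 1"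
| "fl_sum x d (Suc (Suc k)) = (fl_sum x d (Suc k) + x (Suc (Suc k))) * (1 + d (Suc (Suc k)))"

text \<open>The exponent of the \<open>j\<close>-th summand is written \<open>k + 1 - j\<close> because \<open>k - j + 1\<close> would
  truncate at \<open>j = k + 1\<close>.\<close>

definition sum_bound :: "(nat \<Rightarrow> real) \<Rightarrow> real \<Rightarrow> nat \<Rightarrow> real" where
  "sum_bound x u k =
     \<bar>x 1\<bar> * (1 + u) ^ (k - 1) + (\<Sum>j=2..k+1. \<bar>x j\<bar> * (1 + u) ^ (k + 1 - j))"

end

theory Submission
  imports Defs
begin

text \<open>
  Write \<open>z k\<close> for the computed sum \<open>fl_sum x \<delta> k\<close>. Since
  \<open>z (k + 1) = (z k + x (k + 1)) * (1 + \<delta> (k + 1))\<close>, each addition creates the new error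
  \<open>\<delta> (k + 1) * (z k + x (k + 1))\<close> and passes the old one on unchanged, so the total error is
  the sum of these terms (\<open>fl_sum_error\<close>). The factor \<open>z k + x (k + 1)\<close> depends only on
  \<open>\<delta> 2, \<dots>, \<delta> k\<close>, given which \<open>\<delta> (k + 1)\<close> has conditional mean zero. The error is therefore a
  sum of martingale differences, although the \<open>\<delta> k\<close> enter it nonlinearly. Unrolling
  the recurrence bounds the factor by \<open>sum_bound x u k\<close>
  (\<open>fl_sum_add_le_sum_bound\<close>), so the \<open>k\<close>-th difference is at most \<open>u * sum_bound x u k\<close>.

  For martingale differences \<open>D k\<close> bounded by \<open>c k\<close>, the Azuma--Hoeffding inequality gives
  Gaussian tails with variance proxy \<open>\<Sum>k. (c k)\<^sup>2\<close>. It rests on the moment generating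
  function (\<open>azuma_hoeffding_mgf\<close>): the exponential is replaced by its chord on \<open>[- c k, c k]\<close>,
  the linear term of the chord vanishes in expectation, and the constant term
  \<open>cosh (l * c k)\<close> is at most \<open>exp ((l * c k)\<^sup>2 / 2)\<close>. Choosing the deviation at which the
  two-sided tail bound equals \<open>\<eta>\<close> yields the theorem.
\<close>

section \<open>Exponential moments of bounded martingale differences\<close>

text \<open>
  The left side is the moment generating function of a random sign, so this is a case of
  Hoeffding's lemma, with an interval of length \<open>2 * t\<close> centred at the mean.
\<close>

lemma cosh_le_exp_half_square: "cosh t \<le> exp (t\<^sup>2 / 2)" for t :: real
proof -
  have nonneg: "cosh s \<le> exp (s\<^sup>2 / 2)" if "s \<ge> 0" for s :: real
  proof -
    have cosh_eq: "1 + 1/2 * (exp (2 * s) - 1) = exp s * cosh s"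
      by (simp add: cosh_field_def field_simps flip: exp_add)
    have "- (2 * s) * (1/2) + ln (1 + 1/2 * (exp (2 * s) - 1)) \<le> (2 * s)\<^sup>2 / 8"
      by (rule Hoeffdings_lemma_aux) (use that in auto)
    hence "ln (cosh s) \<le> s\<^sup>2 / 2"
      unfolding cosh_eq by (simp add: ln_mult cosh_real_pos power2_eq_square)
    hence "exp (ln (cosh s)) \<le> exp (s\<^sup>2 / 2)"
      unfolding exp_le_cancel_iff .
    thus ?thesis
      by (simp only: exp_ln[OF cosh_real_pos])
  qed
  have "cosh t = cosh \<bar>t\<bar>"
    by (simp add: abs_if)
  also have "\<dots> \<le> exp (t\<^sup>2 / 2)"
    using nonneg[of "\<bar>t\<bar>"] by simp
  finally show ?thesis .
qed

text \<open>
  By convexity the exponential lies below its chord over \<open>[- c, c]\<close>. For \<open>c = 0\<close> the interval is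
  the point \<open>0\<close>, and the slope has the value \<open>0\<close> by the convention on division by zero.
\<close>

lemma exp_le_chord:
  fixes l y c :: real
  assumes "\<bar>y\<bar> \<le> c"
  shows "exp (l * y) \<le> cosh (l * c) + sinh (l * c) / c * y"
proof (cases "c = 0")
  case True
  thus ?thesis using assms by simp
next
  case False
  hence "c > 0" using assms by linarith
  define p where "p = (c + y) / (2 * c)"
  have p: "0 \<le> p" "p \<le> 1"
    using assms \<open>c > 0\<close> by (auto simp: p_def field_simps)
  have y: "l * y = (1 - p) * (- (l * c)) + p * (l * c)"
    using \<open>c > 0\<close> by (simp add: p_def field_simps)
  have "exp (l * y) \<le> (1 - p) * exp (- (l * c)) + p * exp (l * c)"
    unfolding y using convex_onD[OF exp_convex, of p "- (l * c)" "l * c"] p by simp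
  also have "\<dots> = cosh (l * c) + sinh (l * c) / c * y"
    using \<open>c > 0\<close> by (simp add: p_def cosh_field_def sinh_field_def field_simps)
  finally show ?thesis .
qed

text \<open>
  \<open>F k\<close> is the information available just before step \<open>k\<close>: it determines \<open>D j\<close> for \<open>j < k\<close>.
  In the induction step the exponential \<open>W\<close> of the earlier sum is thus known, and the vanishing
  conditional mean of the last term makes \<open>W\<close> orthogonal to it.
\<close>

lemma (in prob_space) azuma_hoeffding_mgf:
  fixes D :: "nat \<Rightarrow> 'a \<Rightarrow> real" and c :: "nat \<Rightarrow> real" and F :: "nat \<Rightarrow> 'a measure"
  assumes "\<And>k. k \<in> {1..n} \<Longrightarrow> subalgebra M (F k)"
    and "\<And>k. k \<in> {1..n} \<Longrightarrow> D k \<in> borel_measurable M"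
    and "\<And>j k. k \<in> {1..n} \<Longrightarrow> j \<in> {1..<k} \<Longrightarrow> D j \<in> borel_measurable (F k)"
    and "\<And>k. k \<in> {1..n} \<Longrightarrow> AE \<omega> in M. \<bar>D k \<omega>\<bar> \<le> c k"
    and "\<And>k. k \<in> {1..n} \<Longrightarrow> AE \<omega> in M. real_cond_exp M (F k) (D k) \<omega> = 0"
  shows "integrable M (\<lambda>\<omega>. exp (l * (\<Sum>k=1..n. D k \<omega>)))"
    and "expectation (\<lambda>\<omega>. exp (l * (\<Sum>k=1..n. D k \<omega>))) \<le> exp (l\<^sup>2 / 2 * (\<Sum>k=1..n. (c k)\<^sup>2))"
proof -
  have "integrable M (\<lambda>\<omega>. exp (l * (\<Sum>k=1..n. D k \<omega>))) \<and>
    expectation (\<lambda>\<omega>. exp (l * (\<Sum>k=1..n. D k \<omega>))) \<le> exp (l\<^sup>2 / 2 * (\<Sum>k=1..n. (c k)\<^sup>2))"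
    using assms
  proof (induction n)
    case 0
    show ?case by (simp add: prob_space)
  next
    case (Suc n)
    define W where "W = (\<lambda>\<omega>. exp (l * (\<Sum>k=1..n. D k \<omega>)))"
    define Y where "Y = D (Suc n)"
    define a where "a = l * c (Suc n)"
    define s where "s = sinh a / c (Suc n)"
    have W_int: "integrable M W"
      and W_le: "expectation W \<le> exp (l\<^sup>2 / 2 * (\<Sum>k=1..n. (c k)\<^sup>2))"
      using Suc.IH Suc.prems by (simp_all add: W_def)
    interpret finite_measure_subalgebra M "F (Suc n)"
      by unfold_locales (use Suc.prems(1) in auto)
    have [measurable]: "Y \<in> borel_measurable M"
      using Suc.prems(2) by (simp add: Y_def)
    have W_F [measurable]: "W \<in> borel_measurable (F (Suc n))"
      unfolding W_def using Suc.prems(3)[of "Suc n"]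
      by (intro borel_measurable_exp[THEN measurable_compose[rotated]] borel_measurable_times
          borel_measurable_const borel_measurable_sum) auto
    have [measurable]: "W \<in> borel_measurable M"
      using W_int by auto
    have Y_le: "AE \<omega> in M. \<bar>Y \<omega>\<bar> \<le> c (Suc n)"
      using Suc.prems(4) by (simp add: Y_def)
    have WY_int: "integrable M (\<lambda>\<omega>. W \<omega> * Y \<omega>)"
    proof (rule Bochner_Integration.integrable_bound)
      show "integrable M (\<lambda>\<omega>. c (Suc n) * W \<omega>)" using W_int by simp
      show "AE \<omega> in M. norm (W \<omega> * Y \<omega>) \<le> norm (c (Suc n) * W \<omega>)"
        using Y_le
      proof eventually_elim
        case (elim \<omega>)
        have "W \<omega> * \<bar>Y \<omega>\<bar> \<le> W \<omega> * c (Suc n)"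
          by (intro mult_left_mono elim) (simp add: W_def)
        moreover have "W \<omega> > 0" by (simp add: W_def)
        ultimately show ?case
          by (simp add: abs_mult mult.commute)
      qed
    qed simp
    \<comment> \<open>Orthogonality: a factor known to \<open>F (Suc n)\<close> may be averaged against the conditional
      expectation of \<open>Y\<close> in place of \<open>Y\<close>.\<close>
    have "expectation (\<lambda>\<omega>. W \<omega> * Y \<omega>)
        = expectation (\<lambda>\<omega>. W \<omega> * real_cond_exp M (F (Suc n)) Y \<omega>)"
      by (rule real_cond_exp_intg(2)[symmetric]) (use WY_int in simp_all)
    also have "\<dots> = expectation (\<lambda>\<omega>. 0)"
      by (rule integral_cong_AE) (use Suc.prems(5)[of "Suc n"] in \<open>auto simp: Y_def\<close>)
    finally have WY_0: "expectation (\<lambda>\<omega>. W \<omega> * Y \<omega>) = 0" by simp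
    have split: "exp (l * (\<Sum>k=1..Suc n. D k \<omega>)) = W \<omega> * exp (l * Y \<omega>)" for \<omega>
      by (simp add: W_def Y_def distrib_left exp_add)
    have chord: "AE \<omega> in M. W \<omega> * exp (l * Y \<omega>) \<le> cosh a * W \<omega> + s * (W \<omega> * Y \<omega>)"
      using Y_le
    proof eventually_elim
      case (elim \<omega>)
      have "W \<omega> * exp (l * Y \<omega>) \<le> W \<omega> * (cosh a + s * Y \<omega>)"
        unfolding a_def s_def by (intro mult_left_mono exp_le_chord elim) (simp add: W_def)
      thus ?case by (simp add: algebra_simps)
    qed
    have rhs_int: "integrable M (\<lambda>\<omega>. cosh a * W \<omega> + s * (W \<omega> * Y \<omega>))"
      using W_int WY_int by simp
    have lhs_int: "integrable M (\<lambda>\<omega>. W \<omega> * exp (l * Y \<omega>))"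
    proof (rule Bochner_Integration.integrable_bound[OF rhs_int])
      show "AE \<omega> in M. norm (W \<omega> * exp (l * Y \<omega>)) \<le> norm (cosh a * W \<omega> + s * (W \<omega> * Y \<omega>))"
        using chord
      proof eventually_elim
        case (elim \<omega>)
        moreover have "W \<omega> * exp (l * Y \<omega>) \<ge> 0" by (simp add: W_def)
        ultimately show ?case by simp
      qed
    qed simp
    have "expectation (\<lambda>\<omega>. W \<omega> * exp (l * Y \<omega>))
        \<le> expectation (\<lambda>\<omega>. cosh a * W \<omega> + s * (W \<omega> * Y \<omega>))"
      by (rule integral_mono_AE[OF lhs_int rhs_int chord])
    also have "\<dots> = cosh a * expectation W"
      using W_int WY_int WY_0 by simp
    also have "\<dots> \<le> exp (a\<^sup>2 / 2) * exp (l\<^sup>2 / 2 * (\<Sum>k=1..n. (c k)\<^sup>2))"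
      by (intro mult_mono cosh_le_exp_half_square W_le) (auto simp: W_def)
    also have "\<dots> = exp (l\<^sup>2 / 2 * (\<Sum>k=1..Suc n. (c k)\<^sup>2))"
      by (simp add: a_def power_mult_distrib algebra_simps flip: exp_add)
    finally show ?case
      using lhs_int by (simp only: split)
  qed
  thus "integrable M (\<lambda>\<omega>. exp (l * (\<Sum>k=1..n. D k \<omega>)))"
    and "expectation (\<lambda>\<omega>. exp (l * (\<Sum>k=1..n. D k \<omega>))) \<le> exp (l\<^sup>2 / 2 * (\<Sum>k=1..n. (c k)\<^sup>2))"
    by auto
qed

section \<open>The Azuma--Hoeffding inequality\<close>

text \<open>
  Both tails follow from the Chernoff bound. The exponent \<open>- l * t + l\<^sup>2 / 2 * C\<close>, with \<open>C\<close> the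
  sum of the squared bounds, is minimal at \<open>l = t / C\<close>.
\<close>

lemma (in prob_space) azuma_hoeffding:
  fixes D :: "nat \<Rightarrow> 'a \<Rightarrow> real" and c :: "nat \<Rightarrow> real" and F :: "nat \<Rightarrow> 'a measure"
  assumes "\<And>k. k \<in> {1..n} \<Longrightarrow> subalgebra M (F k)"
    and "\<And>k. k \<in> {1..n} \<Longrightarrow> D k \<in> borel_measurable M"
    and "\<And>j k. k \<in> {1..n} \<Longrightarrow> j \<in> {1..<k} \<Longrightarrow> D j \<in> borel_measurable (F k)"
    and "\<And>k. k \<in> {1..n} \<Longrightarrow> AE \<omega> in M. \<bar>D k \<omega>\<bar> \<le> c k"
    and "\<And>k. k \<in> {1..n} \<Longrightarrow> AE \<omega> in M. real_cond_exp M (F k) (D k) \<omega> = 0"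
    and C_pos: "(\<Sum>k=1..n. (c k)\<^sup>2) > 0" and t: "t > 0"
  shows "prob {\<omega> \<in> space M. \<bar>\<Sum>k=1..n. D k \<omega>\<bar> \<ge> t}
           \<le> 2 * exp (- t\<^sup>2 / (2 * (\<Sum>k=1..n. (c k)\<^sup>2)))"
proof -
  define C where "C = (\<Sum>k=1..n. (c k)\<^sup>2)"
  define S where "S = (\<lambda>\<omega>. \<Sum>k=1..n. D k \<omega>)"
  define l where "l = t / C"
  have C: "C > 0" using C_pos by (simp add: C_def)
  hence l: "l > 0" using t by (simp add: l_def)
  have S_meas [measurable]: "S \<in> borel_measurable M"
    unfolding S_def using assms(2) by (intro borel_measurable_sum) auto
  have mgf_int: "integrable M (\<lambda>\<omega>. exp (r * S \<omega>))"
    and mgf_le: "expectation (\<lambda>\<omega>. exp (r * S \<omega>)) \<le> exp (r\<^sup>2 / 2 * C)" for r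
    using azuma_hoeffding_mgf[of n F D c r] assms(1-5) by (simp_all add: S_def C_def)
  have mgf_set_int: "set_integrable M (space M) (\<lambda>\<omega>. exp (r * S \<omega>))" for r
    unfolding set_integrable_def by (intro integrable_mult_indicator mgf_int) simp
  have exponent: "exp (- (l * t)) * exp (l\<^sup>2 / 2 * C) = exp (- t\<^sup>2 / (2 * C))"
    using C by (simp add: l_def power2_eq_square field_simps flip: exp_add)
  have "prob {\<omega> \<in> space M. S \<omega> \<ge> t} \<le> exp (- l * t) * (\<integral>\<omega>\<in>space M. exp (l * S \<omega>) \<partial>M)"
    using Chernoff_ineq_ge[OF l mgf_set_int[of l] sets.top, of t] by simp
  also have "\<dots> \<le> exp (- (l * t)) * exp (l\<^sup>2 / 2 * C)"
    using mgf_le[of l] mgf_int[of l] by (simp add: set_integral_space)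
  finally have upper: "prob {\<omega> \<in> space M. S \<omega> \<ge> t} \<le> exp (- t\<^sup>2 / (2 * C))"
    unfolding exponent .
  have "prob {\<omega> \<in> space M. S \<omega> \<le> - t} \<le> exp (l * - t) * (\<integral>\<omega>\<in>space M. exp (- l * S \<omega>) \<partial>M)"
    using Chernoff_ineq_le[OF l mgf_set_int[of "- l"] sets.top, of "- t"] by simp
  also have "\<dots> \<le> exp (- (l * t)) * exp (l\<^sup>2 / 2 * C)"
    using mgf_le[of "- l"] mgf_int[of "- l"] by (simp add: set_integral_space)
  finally have lower: "prob {\<omega> \<in> space M. S \<omega> \<le> - t} \<le> exp (- t\<^sup>2 / (2 * C))"
    unfolding exponent .
  have "{\<omega> \<in> space M. \<bar>S \<omega>\<bar> \<ge> t}
      = {\<omega> \<in> space M. S \<omega> \<ge> t} \<union> {\<omega> \<in> space M. S \<omega> \<le> - t}"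
    by auto
  hence "prob {\<omega> \<in> space M. \<bar>S \<omega>\<bar> \<ge> t}
      \<le> prob {\<omega> \<in> space M. S \<omega> \<ge> t} + prob {\<omega> \<in> space M. S \<omega> \<le> - t}"
    by (simp add: measure_Un_le)
  also have "\<dots> \<le> 2 * exp (- t\<^sup>2 / (2 * C))"
    using upper lower by simp
  finally show ?thesis
    unfolding S_def C_def .
qed

text \<open>
  The tail bound solved for the deviation: \<open>2 * exp (- t\<^sup>2 / (2 * C)) = \<eta>\<close> at
  \<open>t = sqrt (2 * ln (2 / \<eta>)) * sqrt C\<close>. If \<open>C = 0\<close>, all differences vanish almost surely.
\<close>

lemma (in prob_space) azuma_hoeffding_quantile:
  fixes D :: "nat \<Rightarrow> 'a \<Rightarrow> real" and c :: "nat \<Rightarrow> real" and F :: "nat \<Rightarrow> 'a measure"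
  assumes "\<And>k. k \<in> {1..n} \<Longrightarrow> subalgebra M (F k)"
    and "\<And>k. k \<in> {1..n} \<Longrightarrow> D k \<in> borel_measurable M"
    and "\<And>j k. k \<in> {1..n} \<Longrightarrow> j \<in> {1..<k} \<Longrightarrow> D j \<in> borel_measurable (F k)"
    and "\<And>k. k \<in> {1..n} \<Longrightarrow> AE \<omega> in M. \<bar>D k \<omega>\<bar> \<le> c k"
    and "\<And>k. k \<in> {1..n} \<Longrightarrow> AE \<omega> in M. real_cond_exp M (F k) (D k) \<omega> = 0"
    and \<eta>: "0 < \<eta>" "\<eta> < 2"
  shows "prob {\<omega> \<in> space M.
           \<bar>\<Sum>k=1..n. D k \<omega>\<bar> \<le> sqrt (2 * ln (2 / \<eta>)) * sqrt (\<Sum>k=1..n. (c k)\<^sup>2)} \<ge> 1 - \<eta>"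
proof -
  define C where "C = (\<Sum>k=1..n. (c k)\<^sup>2)"
  define S where "S = (\<lambda>\<omega>. \<Sum>k=1..n. D k \<omega>)"
  define t where "t = sqrt (2 * ln (2 / \<eta>)) * sqrt C"
  have C_nonneg: "C \<ge> 0" by (simp add: C_def sum_nonneg)
  have S_meas [measurable]: "S \<in> borel_measurable M"
    unfolding S_def using assms(2) by (intro borel_measurable_sum) auto
  have ln_pos: "ln (2 / \<eta>) > 0" using \<eta> by simp
  have "prob {\<omega> \<in> space M. \<bar>S \<omega>\<bar> \<le> t} \<ge> 1 - \<eta>"
  proof (cases "C = 0")
    case True
    hence c0: "c k = 0" if "k \<in> {1..n}" for k
      using that by (auto simp: C_def sum_nonneg_eq_0_iff)
    have "AE \<omega> in M. \<forall>k\<in>{1..n}. \<bar>D k \<omega>\<bar> \<le> c k"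
      using assms(4) by (intro AE_finite_allI) auto
    hence "AE \<omega> in M. \<bar>S \<omega>\<bar> \<le> t"
    proof eventually_elim
      case (elim \<omega>)
      hence "S \<omega> = 0"
        unfolding S_def by (intro sum.neutral) (auto simp: c0)
      thus ?case by (simp add: t_def True)
    qed
    hence "prob {\<omega> \<in> space M. \<bar>S \<omega>\<bar> \<le> t} = 1"
      by (subst prob_Collect_eq_1) auto
    thus ?thesis using \<eta> by simp
  next
    case False
    hence C: "C > 0" using C_nonneg by simp
    hence t: "t > 0" using ln_pos by (simp add: t_def)
    have "1 - prob {\<omega> \<in> space M. \<bar>S \<omega>\<bar> \<le> t} = prob {\<omega> \<in> space M. \<not> \<bar>S \<omega>\<bar> \<le> t}"
      by (subst prob_neg) auto
    also have "\<dots> \<le> prob {\<omega> \<in> space M. \<bar>S \<omega>\<bar> \<ge> t}"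
      by (intro finite_measure_mono) auto
    also have "\<dots> \<le> 2 * exp (- t\<^sup>2 / (2 * C))"
      unfolding S_def C_def
      by (rule azuma_hoeffding[where F = F]) (use assms(1-5) C t in \<open>auto simp: C_def\<close>)
    also have "- t\<^sup>2 / (2 * C) = - ln (2 / \<eta>)"
      using C ln_pos by (simp add: t_def power_mult_distrib)
    also have "2 * exp (- ln (2 / \<eta>)) = \<eta>"
      using \<eta> by (simp add: exp_minus)
    finally show ?thesis by simp
  qed
  thus ?thesis by (simp add: S_def t_def C_def)
qed

section \<open>Generated algebras\<close>

lemma subalgebra_generated_algebra:
  assumes "\<And>j. j \<in> J \<Longrightarrow> X j \<in> borel_measurable M"
  shows "subalgebra M (generated_algebra M J X)"
proof -
  have "(\<Union>j\<in>J. {X j -` A \<inter> space M | A. A \<in> sets borel}) \<subseteq> sets M"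
    using assms by (auto intro: measurable_sets)
  thus ?thesis
    unfolding subalgebra_def generated_algebra_def
    by (simp add: sets.sigma_sets_subset sets_measure_of_conv space_measure_of_conv)
qed

lemma measurable_generated_algebra:
  assumes "j \<in> J"
  shows "X j \<in> borel_measurable (generated_algebra M J X)"
proof (rule measurableI)
  fix A :: "real set" assume "A \<in> sets borel"
  hence "X j -` A \<inter> space M \<in> (\<Union>j\<in>J. {X j -` A \<inter> space M | A. A \<in> sets borel})"
    using assms by blast
  thus "X j -` A \<inter> space (generated_algebra M J X) \<in> sets (generated_algebra M J X)"
    unfolding generated_algebra_def
    by (simp add: space_measure_of_conv) (auto intro!: in_measure_of)
qed simp

section \<open>The error of sequential summation\<close>

text \<open>
  The computed partial sum depends only on the roundoffs committed so far; with \<open>N\<close> the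
  algebra they generate, this makes it a known factor in the next error term.
\<close>

lemma measurable_fl_sum:
  assumes "\<And>j. j \<in> {2..k} \<Longrightarrow> d j \<in> borel_measurable N"
  shows "(\<lambda>\<omega>. fl_sum x (\<lambda>j. d j \<omega>) k) \<in> borel_measurable N"
  using assms
proof (induction k rule: induct_nat_012)
  case (ge2 k)
  have "(\<lambda>\<omega>. fl_sum x (\<lambda>j. d j \<omega>) (Suc k)) \<in> borel_measurable N"
    by (rule ge2.IH(2)) (use ge2.prems in auto)
  moreover have "d (Suc (Suc k)) \<in> borel_measurable N"
    using ge2.prems by simp
  ultimately show ?case by simp
qed simp_all

text \<open>
  The errors of the single additions add up without amplification because each is measured
  relative to the perturbed sum \<open>fl_sum x d k + x (k + 1)\<close> rather than to the exact one.
\<close>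

lemma fl_sum_error:
  "fl_sum x d (Suc n) - (\<Sum>k=1..Suc n. x k)
     = (\<Sum>k=1..n. d (Suc k) * (fl_sum x d k + x (Suc k)))"
proof (induction n)
  case (Suc n)
  thus ?case by (simp add: algebra_simps)
qed simp

text \<open>
  The recurrence of \<open>\<bar>fl_sum x d k + x (k + 1)\<bar>\<close> in the worst case, where every roundoff is
  \<open>u\<close> and all terms have the same sign. It holds from index 1 on: at index 0 the truncated
  exponent \<open>k - 1\<close> breaks it.
\<close>

lemma sum_bound_Suc:
  "sum_bound x u (Suc (Suc k)) = sum_bound x u (Suc k) * (1 + u) + \<bar>x (Suc (Suc (Suc k)))\<bar>"
proof -
  have "(\<Sum>j=2..Suc (Suc k). \<bar>x j\<bar> * (1 + u) ^ (Suc (Suc k) + 1 - j))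
      = (\<Sum>j=2..Suc (Suc k). \<bar>x j\<bar> * (1 + u) ^ (Suc k + 1 - j)) * (1 + u)"
    unfolding sum_distrib_right by (intro sum.cong refl) (auto simp: Suc_diff_le)
  thus ?thesis
    by (simp add: sum_bound_def algebra_simps)
qed

lemma fl_sum_add_le_sum_bound:
  assumes "\<And>j. j \<in> {2..Suc k} \<Longrightarrow> \<bar>d j\<bar> \<le> u"
  shows "\<bar>fl_sum x d (Suc k) + x (Suc (Suc k))\<bar> \<le> sum_bound x u (Suc k)"
  using assms
proof (induction k)
  case 0
  have "{2..Suc 1} = {2::nat}" by auto
  thus ?case by (simp add: sum_bound_def numeral_2_eq_2)
next
  case (Suc k)
  define z where "z = fl_sum x d (Suc k) + x (Suc (Suc k))"
  have z: "\<bar>z\<bar> \<le> sum_bound x u (Suc k)"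
    unfolding z_def by (rule Suc.IH) (use Suc.prems in auto)
  have d: "\<bar>d (Suc (Suc k))\<bar> \<le> u"
    using Suc.prems by simp
  have "\<bar>z * (1 + d (Suc (Suc k))) + x (Suc (Suc (Suc k)))\<bar>
      \<le> \<bar>z\<bar> * \<bar>1 + d (Suc (Suc k))\<bar> + \<bar>x (Suc (Suc (Suc k)))\<bar>"
    by (metis abs_mult abs_triangle_ineq)
  also have "\<dots> \<le> sum_bound x u (Suc k) * (1 + u) + \<bar>x (Suc (Suc (Suc k)))\<bar>"
    using z d by (intro add_right_mono mult_mono) auto
  finally show ?case
    by (simp add: sum_bound_Suc z_def)
qed

section \<open>The probabilistic error bound\<close>

theorem theorem5p7:
  fixes M :: "'a measure"
    and n :: nat
    and x :: "nat \<Rightarrow> real"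
    and u \<eta> :: real
    and \<delta> :: "nat \<Rightarrow> 'a \<Rightarrow> real"
  assumes "prob_space M"
    and "n \<ge> 2"
    and "(\<Sum>k=1..n. x k) \<noteq> 0"
    and "u > 0"
    and "0 < \<eta>" and "\<eta> < 1"
    and "\<And>k. k \<in> {2..n} \<Longrightarrow> \<delta> k \<in> borel_measurable M"
    and "\<And>k. k \<in> {2..n} \<Longrightarrow> AE \<omega> in M. \<bar>\<delta> k \<omega>\<bar> \<le> u"
    and "\<And>k. k \<in> {2..n} \<Longrightarrow> (\<integral>\<omega>. \<delta> k \<omega> \<partial>M) = 0"
    and "mean_independent M {2..n} \<delta>"
  shows "measure M {\<omega> \<in> space M.
            \<bar>fl_sum x (\<lambda>k. \<delta> k \<omega>) n - (\<Sum>k=1..n. x k)\<bar> / \<bar>\<Sum>k=1..n. x k\<bar>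
              \<le> u * sqrt (2 * ln (2 / \<eta>)) * sqrt (\<Sum>k=1..n-1. (sum_bound x u k)\<^sup>2)
                  / \<bar>\<Sum>k=1..n. x k\<bar>} \<ge> 1 - \<eta>"
proof -
  interpret prob_space M by fact
  define N where "N = n - 1"
  have n: "n = Suc N" using assms(2) by (simp add: N_def)
  \<comment> \<open>Step \<open>k\<close> is the addition of \<open>x (k + 1)\<close>: \<open>F k\<close> is generated by the roundoffs before
    \<open>\<delta> (k + 1)\<close>, \<open>s k\<close> is the sum that gets rounded, and \<open>D k\<close> is the error made in rounding it.\<close>
  define F where "F = (\<lambda>k. generated_algebra M {j \<in> {2..n}. j < Suc k} \<delta>)"
  define s where "s = (\<lambda>k \<omega>. fl_sum x (\<lambda>j. \<delta> j \<omega>) k + x (Suc k))"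
  define D where "D = (\<lambda>k \<omega>. s k \<omega> * \<delta> (Suc k) \<omega>)"
  define c where "c = (\<lambda>k. u * sum_bound x u k)"
  have subalg: "subalgebra M (F k)" for k
    unfolding F_def by (intro subalgebra_generated_algebra) (use assms(7) in auto)
  have \<delta>_F: "\<delta> j \<in> borel_measurable (F k)" if "j \<in> {2..n}" "j < Suc k" for j k
    unfolding F_def by (rule measurable_generated_algebra) (use that in auto)
  have s_F: "s j \<in> borel_measurable (F k)" if "k \<in> {1..N}" "j \<le> k" for j k
    unfolding s_def using that
    by (intro borel_measurable_add measurable_fl_sum borel_measurable_const \<delta>_F) (auto simp: n)
  have D_M: "D k \<in> borel_measurable M" if "k \<in> {1..N}" for k
    unfolding D_def
    by (intro borel_measurable_times measurable_from_subalg[OF subalg s_F[OF that]] assms(7))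
       (use that in \<open>auto simp: n\<close>)
  have D_F: "D j \<in> borel_measurable (F k)" if "k \<in> {1..N}" "j \<in> {1..<k}" for j k
    unfolding D_def using that
    by (intro borel_measurable_times s_F \<delta>_F) (auto simp: n)
  have all_\<delta>: "AE \<omega> in M. \<forall>k\<in>{2..n}. \<bar>\<delta> k \<omega>\<bar> \<le> u"
    using assms(8) by (intro AE_finite_allI) auto
  have D_le: "AE \<omega> in M. \<bar>D k \<omega>\<bar> \<le> c k" if k: "k \<in> {1..N}" for k
    using all_\<delta>
  proof eventually_elim
    case (elim \<omega>)
    obtain i where i: "k = Suc i" using k by (cases k) auto
    have "\<bar>s k \<omega>\<bar> \<le> sum_bound x u k"
      unfolding s_def i by (rule fl_sum_add_le_sum_bound) (use elim k in \<open>auto simp: i n\<close>)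
    moreover have "\<bar>\<delta> (Suc k) \<omega>\<bar> \<le> u"
      using elim k by (auto simp: n)
    ultimately show ?case
      unfolding D_def c_def abs_mult mult.commute[of u] by (intro mult_mono) auto
  qed
  have D_0: "AE \<omega> in M. real_cond_exp M (F k) (D k) \<omega> = 0" if k: "k \<in> {1..N}" for k
  proof -
    interpret finite_measure_subalgebra M "F k"
      by unfold_locales (rule subalg)
    have Suc_k: "Suc k \<in> {2..n}" using k by (auto simp: n)
    have D_int: "integrable M (\<lambda>\<omega>. s k \<omega> * \<delta> (Suc k) \<omega>)"
    proof (rule integrable_const_bound)
      show "AE \<omega> in M. norm (s k \<omega> * \<delta> (Suc k) \<omega>) \<le> c k"
        using D_le[OF k] by (simp add: D_def)
    qed (use D_M[OF k] in \<open>simp add: D_def\<close>)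
    have "AE \<omega> in M. real_cond_exp M (F k) (D k) \<omega>
            = s k \<omega> * real_cond_exp M (F k) (\<delta> (Suc k)) \<omega>"
      unfolding D_def
      by (rule real_cond_exp_mult[OF s_F[OF k order_refl] assms(7)[OF Suc_k] D_int])
    moreover have "AE \<omega> in M. real_cond_exp M (F k) (\<delta> (Suc k)) \<omega> = 0"
      using assms(10) Suc_k assms(9)[OF Suc_k] unfolding mean_independent_def F_def by fastforce
    ultimately show ?thesis by eventually_elim simp
  qed
  have error: "fl_sum x (\<lambda>k. \<delta> k \<omega>) n - (\<Sum>k=1..n. x k) = (\<Sum>k=1..N. D k \<omega>)" for \<omega>
    unfolding n fl_sum_error by (simp add: D_def s_def mult.commute)
  have "sqrt (\<Sum>k=1..N. (c k)\<^sup>2) = u * sqrt (\<Sum>k=1..N. (sum_bound x u k)\<^sup>2)"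
    using assms(4)
    by (simp add: c_def power_mult_distrib real_sqrt_mult flip: sum_distrib_left)
  hence bound: "sqrt (2 * ln (2 / \<eta>)) * sqrt (\<Sum>k=1..N. (c k)\<^sup>2)
      = u * sqrt (2 * ln (2 / \<eta>)) * sqrt (\<Sum>k=1..n-1. (sum_bound x u k)\<^sup>2)"
    by (simp add: N_def)
  have "prob {\<omega> \<in> space M. \<bar>\<Sum>k=1..N. D k \<omega>\<bar>
          \<le> sqrt (2 * ln (2 / \<eta>)) * sqrt (\<Sum>k=1..N. (c k)\<^sup>2)} \<ge> 1 - \<eta>"
    by (rule azuma_hoeffding_quantile[where F = F])
       (use subalg D_M D_F D_le D_0 assms(5,6) in auto)
  moreover have "(a / \<bar>\<Sum>k=1..n. x k\<bar> \<le> b / \<bar>\<Sum>k=1..n. x k\<bar>) = (a \<le> b)" for a b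
    using assms(3) by (simp add: divide_le_cancel)
  ultimately show ?thesis
    unfolding error bound by simp
qed

end
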